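(* Let $n$ be a positive integer and $b,h>0$. Let $X$ be a union of $n$ $H$-triangles, each of base $b$ and height $h$, whose interiors are pairwise disjoint. Then $X$ cannot be covered by $n+1$ $H$-triangles each of which has base less than $b$ and height less than $h$.
   Context: An $H$-triangle is a triangle in the plane with one side parallel to the $x$-axis. Its base is the length of this side $l$ parallel to the $x$-axis, and its height is the distance between $l$ and the vertex of the triangle not on $l$. The $H$-triangles are not required to be congruent or similar to one another. "Cover" means the union of the covering triangles contains $X$. *)

theory Defs
  imports "HOL-Analysis.Analysis"
begin

text \<open>
  \<open>H_triangle T b h\<close>: the closed nondegenerate triangle \<open>T\<close> in the plane has a side
  \<open>pq\<close> parallel to the \<open>x\<close>-axis (possibly contained in it), with base \<open>b\<close> and height \<open>h\<close>.
  The height is measured to the line through \<open>p\<close> and \<open>q\<close>, not to the segment; the two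
  differ when the triangle has an obtuse angle at \<open>p\<close> or \<open>q\<close>.
\<close>

definition H_triangle :: "(real^2) set \<Rightarrow> real \<Rightarrow> real \<Rightarrow> bool" where
  "H_triangle T b h \<longleftrightarrow>
     (\<exists>p q r. \<not> collinear {p, q, r} \<and> T = convex hull {p, q, r} \<and> p $ 2 = q $ 2 \<and>
        b = dist p q \<and> h = infdist r (affine hull {p, q}))"

lemma infdist_horizontal_line:
  fixes p q r :: "real^2"
  assumes "p \<noteq> q" "p $ 2 = q $ 2"
  shows "infdist r (affine hull {p, q}) = \<bar>r $ 2 - p $ 2\<bar>"
proof (rule antisym)
  have ne: "p $ 1 \<noteq> q $ 1"
    using assms by (auto simp: vec_eq_iff forall_2)
  define t where "t = (r $ 1 - p $ 1) / (q $ 1 - p $ 1)"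
  define f where "f = (1 - t) *\<^sub>R p + t *\<^sub>R q"
  have f: "f \<in> affine hull {p, q}"
    unfolding affine_hull_2 f_def by force
  have "t * (q $ 1 - p $ 1) = r $ 1 - p $ 1"
    using ne by (simp add: t_def)
  then have f1: "f $ 1 = r $ 1"
    by (simp add: f_def algebra_simps)
  have f2: "f $ 2 = p $ 2"
    using assms by (simp add: f_def algebra_simps)
  have "dist r f = \<bar>r $ 2 - p $ 2\<bar>"
    using f1 f2 by (simp add: dist_vec_def L2_set_def sum_2 dist_real_def)
  then show "infdist r (affine hull {p, q}) \<le> \<bar>r $ 2 - p $ 2\<bar>"
    using infdist_le[OF f, of r] by simp
next
  have "\<bar>r $ 2 - p $ 2\<bar> \<le> dist r y" if y: "y \<in> affine hull {p, q}" for y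
  proof -
    obtain u v where uv: "y = u *\<^sub>R p + v *\<^sub>R q" "u + v = 1"
      using y unfolding affine_hull_2 by auto
    have "y $ 2 = (u + v) * p $ 2"
      using assms by (simp add: uv(1) algebra_simps)
    then have "y $ 2 = p $ 2"
      using uv(2) by simp
    then show ?thesis
      using dist_vec_nth_le[of r 2 y] by (simp add: dist_real_def)
  qed
  moreover have "affine hull {p, q} \<noteq> {}"
    by simp
  ultimately show "\<bar>r $ 2 - p $ 2\<bar> \<le> infdist r (affine hull {p, q})"
    by (auto simp: infdist_def intro!: cINF_greatest)
qed

end

theory Submission imports Defs
begin

text \<open>
  Choose \<open>l < 1\<close> so that every covering triangle has base at most \<open>l b\<close> and height at most \<open>l h\<close>.
  Compare the lengths of the horizontal slices at the levels congruent to \<open>y\<close> modulo \<open>l h\<close>.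
  In the unit \<open>l b\<close>, a covering triangle contributes at most \<open>1 - frac (\<plusminus> (y / (l h) - c))\<close>, and each
  of the \<open>n\<close> given triangles at least \<open>1 / l - 1\<close> more than such a sawtooth. The difference of the
  \<open>n + 1\<close> and the \<open>n\<close> sawtooth functions has average 1/2 and is bounded below by a positive
  constant \<open>\<delta>\<close>. All slopes being \<open>\<plusminus>1\<close>, it is congruent modulo 1 to an affine function of odd,
  hence nonzero, slope, so its excess over \<open>\<delta>\<close> has average at least 1/2, a contradiction.
\<close>

section \<open>Slice lengths as translates of one profile\<close>

text \<open>This is the length of the slice of a triangle of base 1 at relative height
  \<open>x\<close> over its base line; the jump at 0 is the base itself.\<close>

definition hat :: "real \<Rightarrow> real" where
  "hat x = (if 0 \<le> x \<and> x < 1 then 1 - x else 0)"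

lemma hat_nonneg: "0 \<le> hat x"
  by (simp add: hat_def)

text \<open>Slices do not get shorter when base and height grow while base line and orientation stay
  fixed. This allows all covering triangles to be enlarged to one size.\<close>

lemma hat_scale_mono:
  assumes "0 < h'" "h' \<le> h" "b' \<le> b" "0 \<le> b"
  shows "b' * hat (x / h') \<le> b * hat (x / h)"
proof (cases "0 \<le> x \<and> x < h'")
  case True
  then have "x / h \<le> x / h'" "x / h' < 1" "0 \<le> x / h"
    using assms by (auto intro: divide_left_mono)
  then have "hat (x / h') \<le> hat (x / h)"
    using True assms by (auto simp: hat_def)
  then show ?thesis
    using assms hat_nonneg[of "x / h'"] by (meson mult_mono)
next
  case False
  then have "hat (x / h') = 0"
    using assms by (auto simp: hat_def field_simps zero_le_divide_iff)
  then show ?thesis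
    using assms hat_nonneg[of "x / h"] by simp
qed

text \<open>The supports of the integer translates of \<open>hat\<close> are half-open unit
  intervals tiling the line, so only the index \<open>k\<close> below can give a nonzero term,
  namely \<open>hat (frac x)\<close>.\<close>

lemma sum_hat_translates_le:
  assumes "finite M" "\<sigma> \<in> {1, - 1 :: int}"
  shows "(\<Sum>m\<in>M. hat (x + of_int (\<sigma> * m))) \<le> 1 - frac x"
proof -
  define k where "k = - \<sigma> * \<lfloor>x\<rfloor>"
  have zero: "hat (x + of_int (\<sigma> * m)) = 0" if "m \<noteq> k" for m
  proof (rule ccontr)
    assume "hat (x + of_int (\<sigma> * m)) \<noteq> 0"
    then have "0 \<le> x + of_int (\<sigma> * m)" "x + of_int (\<sigma> * m) < 1"
      by (auto simp: hat_def split: if_splits)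
    then have "\<lfloor>x\<rfloor> = - (\<sigma> * m)"
      by (intro floor_unique) auto
    then show False
      using that assms(2) by (auto simp: k_def)
  qed
  have "(\<Sum>m\<in>M. hat (x + of_int (\<sigma> * m))) \<le> (\<Sum>m\<in>insert k M. hat (x + of_int (\<sigma> * m)))"
    using assms(1) hat_nonneg by (intro sum_mono2) auto
  also have "\<dots> = (\<Sum>m\<in>{k}. hat (x + of_int (\<sigma> * m)))"
    using assms(1) zero by (intro sum.mono_neutral_right) auto
  also have "\<dots> = hat (frac x)"
    using assms(2) by (auto simp: k_def frac_def)
  also have "\<dots> = 1 - frac x"
    using frac_lt_1[of x] by (simp add: hat_def)
  finally show ?thesis .
qed

section \<open>Sums of fractional parts along arithmetic progressions\<close>

lemma frac_of_int_add_divide: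
  fixes p :: nat
  assumes "0 < p" "0 \<le> t" "t < 1"
  shows "frac ((of_int k + t) / real p) = (of_int (k mod int p) + t) / real p"
proof -
  have "(of_int k + t) / real p - (of_int (k mod int p) + t) / real p = of_int (k div int p)"
  proof -
    have "of_int k = real p * of_int (k div int p) + (of_int (k mod int p) :: real)"
      by (metis mult_div_mod_eq of_int_add of_int_mult of_int_of_nat_eq)
    then show ?thesis
      using assms by (simp add: field_simps)
  qed
  then have "(of_int k + t) / real p - (of_int (k mod int p) + t) / real p \<in> \<int>"
    by simp
  moreover have "0 \<le> (of_int (k mod int p) + t) / real p"
    using assms by simp
  moreover have "(of_int (k mod int p) + t) / real p < 1"
  proof -
    have "k mod int p \<le> int p - 1"
      using assms by simp
    then have "(of_int (k mod int p) :: real) \<le> real p - 1"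
      by linarith
    then show ?thesis
      using assms by simp
  qed
  ultimately show ?thesis
    by (simp add: frac_unique_iff)
qed

text \<open>With \<open>p * x = k + t\<close>, the numerators \<open>k + d * j\<close> run through
  every residue modulo \<open>p\<close> exactly once because \<open>d\<close> is coprime to
  \<open>p\<close>. So the sum depends on \<open>x\<close> only through \<open>frac (p * x)\<close>
  and stays within 1 of \<open>(p - 1) / 2\<close>.\<close>

lemma sum_frac_arithmetic_progression:
  fixes p :: nat and d :: int
  assumes "0 < p" "coprime d (int p)"
  shows "(\<Sum>j<p. frac (x + of_int d * real j / real p)) = (real p - 1) / 2 + frac (real p * x)"
proof -
  define k where "k = \<lfloor>real p * x\<rfloor>"
  define t where "t = frac (real p * x)"
  have t: "0 \<le> t" "t < 1"
    by (auto simp: t_def frac_lt_1)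
  have px: "real p * x = of_int k + t"
    by (simp add: k_def t_def frac_def)
  have eq: "x + of_int d * real j / real p = (of_int (k + d * int j) + t) / real p" for j
    using px assms(1) by (simp add: field_simps)
  define g where "g j = nat ((k + d * int j) mod int p)" for j
  have inj: "inj_on g {..<p}"
  proof (rule inj_onI)
    fix i j assume ij: "i \<in> {..<p}" "j \<in> {..<p}" "g i = g j"
    then have "(k + d * int i) mod int p = (k + d * int j) mod int p"
      using assms(1) by (simp add: g_def nat_eq_iff)
    then have "int p dvd (k + d * int i) - (k + d * int j)"
      by (simp add: mod_eq_dvd_iff)
    then have "int p dvd d * (int i - int j)"
      by (simp add: algebra_simps)
    then have "int p dvd int i - int j"
      using assms(2) by (simp add: coprime_commute coprime_dvd_mult_right_iff)
    then show "i = j"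
      using ij zdvd_imp_le[of "int p" "int i - int j"] zdvd_imp_le[of "int p" "int j - int i"]
      by (cases i j rule: linorder_cases) (auto simp: dvd_diff_commute)
  qed
  have "g ` {..<p} \<subseteq> {..<p}"
    using assms(1) by (auto simp: g_def nat_less_iff)
  then have im: "g ` {..<p} = {..<p}"
    using inj by (intro card_subset_eq) (auto simp: card_image)
  have "(\<Sum>j<p. frac (x + of_int d * real j / real p)) = (\<Sum>j<p. (real (g j) + t) / real p)"
    unfolding eq using assms(1) t
    by (intro sum.cong refl) (simp only: frac_of_int_add_divide, simp add: g_def)
  also have "\<dots> = ((\<Sum>j<p. real (g j)) + real p * t) / real p"
    by (simp add: sum_divide_distrib[symmetric] sum.distrib)
  also have "(\<Sum>j<p. real (g j)) = (\<Sum>j<p. real j)"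
    using sum.reindex[OF inj, of real] im by simp
  also have "(\<Sum>j<p. real j) = real p * (real p - 1) / 2"
    by (induction p) (auto simp: field_simps)
  also have "(real p * (real p - 1) / 2 + real p * t) / real p = (real p - 1) / 2 + t"
    using assms(1) by (simp add: field_simps)
  finally show ?thesis
    by (simp add: t_def)
qed

section \<open>Incompatibility of sawtooth sums\<close>

text \<open>Signs are odd numbers. Hence sums of \<open>n\<close> and of \<open>n + 1\<close> signs
  differ by an odd number, which makes the slope below coprime to powers of 2.\<close>

lemma even_sum_signs_iff:
  fixes \<sigma> :: "nat \<Rightarrow> int"
  assumes "\<And>k. k < n \<Longrightarrow> \<sigma> k \<in> {1, - 1}"
  shows "even (\<Sum>k<n. \<sigma> k) \<longleftrightarrow> even n"
  using assms
proof (induction n)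
  case (Suc n)
  have "odd (\<sigma> n)"
    using Suc.prems[of n] by auto
  then show ?case
    using Suc by simp
qed simp

text \<open>Averages are taken over \<open>2 ^ N\<close> equidistant points, a number coprime to the odd slope;
  the exceptional set \<open>Z\<close> is avoided by a generic choice of the starting point.\<close>

lemma sawtooth_sums_contradiction:
  fixes \<sigma> \<tau> :: "nat \<Rightarrow> int" and a c :: "nat \<Rightarrow> real"
  assumes "0 < \<delta>"
    and \<tau>: "\<And>i. i < n \<Longrightarrow> \<tau> i \<in> {1, - 1}"
    and \<sigma>: "\<And>k. k < n + 1 \<Longrightarrow> \<sigma> k \<in> {1, - 1}"
    and "countable Z"
    and ineq: "\<And>u. u \<notin> Z \<Longrightarrow> \<delta> + (\<Sum>i<n. 1 - frac (of_int (\<tau> i) * (u - a i)))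
                  \<le> (\<Sum>k<n + 1. 1 - frac (of_int (\<sigma> k) * (u - c k)))"
  shows False
proof -
  \<comment> \<open>Averaging over \<open>p\<close> points leaves a total error of at most
    \<open>n + 1\<close>; \<open>p\<close> is made so large that the gain
    \<open>p * \<delta>\<close> exceeds it.\<close>
  obtain N where "(real n + 1) / \<delta> < 2 ^ N"
    using real_arch_pow[of 2] by auto
  define p :: nat where "p = 2 ^ N"
  have p: "0 < p" "(real n + 1) < real p * \<delta>"
    using \<open>(real n + 1) / \<delta> < 2 ^ N\<close> \<open>0 < \<delta>\<close> by (auto simp: p_def field_simps)
  define bad where "bad = (\<Union>j<p. (\<lambda>z. z - real j / real p) ` Z)"
  have "countable bad"
    using \<open>countable Z\<close> by (auto simp: bad_def)
  then obtain v where v: "v \<notin> bad"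
    using uncountable_UNIV_real by (metis UNIV_eq_I)
  define u where "u j = v + real j / real p" for j
  have u: "u j \<notin> Z" if "j < p" for j
  proof
    assume "u j \<in> Z"
    then have "v \<in> bad"
      using that by (auto simp: bad_def u_def intro!: bexI[of _ j] image_eqI[of _ _ "u j"])
    with v show False ..
  qed
  \<comment> \<open>Since \<open>frac x\<close> is \<open>x\<close> minus an integer,
    \<open>G\<close> below is affine with slope \<open>d\<close> modulo 1; \<open>e\<close> collects
    the constant terms of \<open>G u - \<delta>\<close>.\<close>
  define d where "d = (\<Sum>i<n. \<tau> i) - (\<Sum>k<n + 1. \<sigma> k)"
  have "odd d"
    using even_sum_signs_iff[of n \<tau>] even_sum_signs_iff[of "n + 1" \<sigma>] \<tau> \<sigma>
    unfolding d_def by simp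
  define e where "e = - (\<Sum>i<n. of_int (\<tau> i) * a i) + (\<Sum>k<n + 1. of_int (\<sigma> k) * c k) - \<delta>"
  define G where "G u = (\<Sum>k<n + 1. 1 - frac (of_int (\<sigma> k) * (u - c k)))
                  - (\<Sum>i<n. 1 - frac (of_int (\<tau> i) * (u - a i)))" for u
  have G_eq: "G u = 1 + (\<Sum>i<n. frac (of_int (\<tau> i) * (u - a i)))
                  - (\<Sum>k<n + 1. frac (of_int (\<sigma> k) * (u - c k)))" for u
    unfolding G_def sum_subtractf by simp
  \<comment> \<open>\<open>G u - \<delta>\<close> is nonnegative and congruent to
    \<open>d * u + e\<close> modulo 1, and a nonnegative real is at least the fractional part of
    anything congruent to it.\<close>
  have G_ge: "frac (of_int d * u + e) \<le> G u - \<delta>" if "u \<notin> Z" for u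
  proof -
    have "0 \<le> G u - \<delta>"
      using ineq[OF that] unfolding G_def by simp
    define m where "m = 1 - (\<Sum>i<n. \<lfloor>of_int (\<tau> i) * (u - a i)\<rfloor>)
         + (\<Sum>k<n + 1. \<lfloor>of_int (\<sigma> k) * (u - c k)\<rfloor>)"
    have m: "G u - \<delta> = of_int d * u + e + of_int m"
      unfolding G_eq e_def d_def frac_def m_def
      by (simp add: sum_subtractf sum.distrib sum_distrib_right sum_distrib_left algebra_simps)
    with \<open>0 \<le> G u - \<delta>\<close> have "- m \<le> \<lfloor>of_int d * u + e\<rfloor>"
      by (simp add: le_floor_iff)
    then have "of_int (- m) \<le> (of_int \<lfloor>of_int d * u + e\<rfloor> :: real)"
      by (simp only: of_int_le_iff)
    then show ?thesis
      using m by (simp add: frac_def)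
  qed
  have sum_sign: "(\<Sum>j<p. frac (of_int s * (u j - y))) = (real p - 1) / 2 + frac (real p * (of_int s * (v - y)))"
    if "s \<in> {1, - 1}" for s y
  proof -
    have "of_int s * (u j - y) = of_int s * (v - y) + of_int s * real j / real p" for j
      by (simp add: u_def algebra_simps)
    moreover have "coprime s (int p)"
      using that by auto
    ultimately show ?thesis
      using sum_frac_arithmetic_progression[OF p(1), of s "of_int s * (v - y)"] by simp
  qed
  have "(\<Sum>j<p. frac (of_int d * u j + e)) = (\<Sum>j<p. frac ((of_int d * v + e) + of_int d * real j / real p))"
    by (simp add: u_def algebra_simps)
  also have "\<dots> = (real p - 1) / 2 + frac (real p * (of_int d * v + e))"
    using \<open>odd d\<close> by (intro sum_frac_arithmetic_progression p(1)) (simp add: p_def coprime_power_right_iff)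
  also have "\<dots> \<ge> (real p - 1) / 2"
    by simp
  finally have "(real p - 1) / 2 \<le> (\<Sum>j<p. frac (of_int d * u j + e))" .
  also have "\<dots> \<le> (\<Sum>j<p. G (u j) - \<delta>)"
    using u G_ge by (intro sum_mono) auto
  also have "\<dots> = real p - real p * \<delta> + (\<Sum>i<n. \<Sum>j<p. frac (of_int (\<tau> i) * (u j - a i)))
       - (\<Sum>k<n + 1. \<Sum>j<p. frac (of_int (\<sigma> k) * (u j - c k)))"
    unfolding G_eq sum_subtractf sum.distrib
    by (subst (2 3) sum.swap) (simp add: algebra_simps)
  \<comment> \<open>Each sawtooth has average close to 1/2, whatever its sign and phase. The
    \<open>n + 1\<close> ones exceed the \<open>n\<close> ones by about \<open>p / 2\<close> in
    total, which leaves no room for \<open>p * \<delta>\<close>.\<close>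
  also have "\<dots> \<le> real p - real p * \<delta> + (\<Sum>i<n. (real p - 1) / 2 + 1) - (\<Sum>k<n + 1. (real p - 1) / 2)"
  proof -
    have "(\<Sum>i<n. \<Sum>j<p. frac (of_int (\<tau> i) * (u j - a i))) \<le> (\<Sum>i<n. (real p - 1) / 2 + 1)"
      using \<tau> by (intro sum_mono) (simp add: sum_sign less_imp_le[OF frac_lt_1])
    moreover have "(\<Sum>k<n + 1. (real p - 1) / 2) \<le> (\<Sum>k<n + 1. \<Sum>j<p. frac (of_int (\<sigma> k) * (u j - c k)))"
      using \<sigma> by (intro sum_mono) (simp add: sum_sign)
    ultimately show ?thesis
      by linarith
  qed
  also have "\<dots> = real p - real p * \<delta> + real n - (real p - 1) / 2"
    by (simp add: field_simps)
  finally have "real p * \<delta> \<le> real n + 1"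
    by (simp add: field_simps)
  then show False
    using p(2) by simp
qed

section \<open>From triangular profiles to sawtooths\<close>

text \<open>Here \<open>u\<close> measures levels in units of the enlarged covering height, so the
  given triangles have height \<open>1 / l > 1\<close>. Summing the hypothesis over finitely many
  integer translates of \<open>u\<close> turns it into a sawtooth inequality with gain
  \<open>1 / l - 1\<close>.\<close>

lemma hat_sums_contradiction:
  fixes \<sigma> \<tau> :: "nat \<Rightarrow> int" and a c :: "nat \<Rightarrow> real"
  assumes "1 \<le> n" and l: "0 < l" "l < 1"
    and \<tau>: "\<And>i. i < n \<Longrightarrow> \<tau> i \<in> {1, - 1}"
    and \<sigma>: "\<And>k. k < n + 1 \<Longrightarrow> \<sigma> k \<in> {1, - 1}"
    and ineq: "\<And>u. u \<notin> a ` {..<n} \<Longrightarrow> (\<Sum>i<n. hat (l * (of_int (\<tau> i) * (u - a i))))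
                  \<le> l * (\<Sum>k<n + 1. hat (of_int (\<sigma> k) * (u - c k)))"
  shows False
proof -
  \<comment> \<open>The hypothesis is available only off the levels \<open>a i\<close>, so all their
    integer translates are excluded.\<close>
  define Z where "Z = (\<Union>i<n. range (\<lambda>m::int. a i - of_int m))"
  have "countable Z"
    by (auto simp: Z_def)
  have "1 / l - 1 + (\<Sum>i<n. 1 - frac (of_int (\<tau> i) * (u - a i)))
           \<le> (\<Sum>k<n + 1. 1 - frac (of_int (\<sigma> k) * (u - c k)))" if "u \<notin> Z" for u
  proof -
    define x where "x i = of_int (\<tau> i) * (u - a i)" for i
    \<comment> \<open>The shift by \<open>m i\<close> puts the level at distance
      \<open>frac (x i)\<close> from the base line \<open>a i\<close>, on the side of the triangle.
      \<open>M\<close> contains such a shift for each \<open>i\<close> and is finite.\<close>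
    define m where "m i = - \<tau> i * \<lfloor>x i\<rfloor>" for i
    define M where "M = m ` {..<n}"
    have x_m: "of_int (\<tau> i) * (u + of_int (m i) - a i) = frac (x i)" if "i < n" for i
      using \<tau>[OF that] by (auto simp: x_def m_def frac_def)
    have notin: "u + of_int k \<notin> a ` {..<n}" for k :: int
    proof
      assume "u + of_int k \<in> a ` {..<n}"
      then obtain i where "i < n" "u = a i - of_int k"
        by (auto simp: eq_diff_eq)
      then show False
        using \<open>u \<notin> Z\<close> by (auto simp: Z_def)
    qed
    have "(\<Sum>i<n. 1 / l - frac (x i)) \<le> (\<Sum>i<n. \<Sum>k\<in>M. hat (l * (of_int (\<tau> i) * (u + of_int k - a i))) / l)"
    proof (rule sum_mono)
      fix i assume "i \<in> {..<n}"
      \<comment> \<open>As the height \<open>1 / l\<close> exceeds 1, the shifted level is short of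
        the apex and its slice has length \<open>1 / l - frac (x i)\<close>.\<close>
      have "l * frac (x i) < 1"
        using l mult_right_mono[of l 1 "frac (x i)"] frac_lt_1[of "x i"] by simp
      then have "1 / l - frac (x i) = hat (l * frac (x i)) / l"
        using l by (simp add: hat_def field_simps)
      also have "\<dots> = (\<Sum>k\<in>{m i}. hat (l * (of_int (\<tau> i) * (u + of_int k - a i))) / l)"
        using x_m \<open>i \<in> {..<n}\<close> by simp
      also have "\<dots> \<le> (\<Sum>k\<in>M. hat (l * (of_int (\<tau> i) * (u + of_int k - a i))) / l)"
        using \<open>i \<in> {..<n}\<close> l hat_nonneg by (intro sum_mono2) (auto simp: M_def)
      finally show "1 / l - frac (x i) \<le> (\<Sum>k\<in>M. hat (l * (of_int (\<tau> i) * (u + of_int k - a i))) / l)" .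
    qed
    also have "\<dots> = (\<Sum>k\<in>M. (\<Sum>i<n. hat (l * (of_int (\<tau> i) * (u + of_int k - a i)))) / l)"
      by (subst sum.swap) (simp add: sum_divide_distrib)
    also have "\<dots> \<le> (\<Sum>k\<in>M. \<Sum>j<n + 1. hat (of_int (\<sigma> j) * (u + of_int k - c j)))"
      using ineq[OF notin] l by (intro sum_mono) (simp add: field_simps)
    also have "\<dots> = (\<Sum>j<n + 1. \<Sum>k\<in>M. hat (of_int (\<sigma> j) * (u - c j) + of_int (\<sigma> j * k)))"
      by (subst sum.swap) (simp add: algebra_simps)
    also have "\<dots> \<le> (\<Sum>j<n + 1. 1 - frac (of_int (\<sigma> j) * (u - c j)))"
      using \<sigma> by (intro sum_mono sum_hat_translates_le) (auto simp: M_def)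
    finally have "(\<Sum>i<n. 1 / l - frac (x i)) \<le> (\<Sum>j<n + 1. 1 - frac (of_int (\<sigma> j) * (u - c j)))" .
    moreover have "1 / l - 1 + (\<Sum>i<n. 1 - frac (x i)) \<le> (\<Sum>i<n. 1 / l - frac (x i))"
    proof -
      \<comment> \<open>Each given triangle has a surplus of \<open>1 / l - 1\<close> over its
        sawtooth; \<open>1 \<le> n\<close> guarantees at least one.\<close>
      have "1 * (1 / l - 1) \<le> real n * (1 / l - 1)"
        using l \<open>1 \<le> n\<close> by (intro mult_right_mono) auto
      then show ?thesis
        by (simp add: sum_subtractf algebra_simps)
    qed
    ultimately show ?thesis
      by (simp add: x_def)
  qed
  moreover have "0 < 1 / l - 1"
    using l by simp
  ultimately show False
    using sawtooth_sums_contradiction[of "1 / l - 1" n \<tau> \<sigma> Z a c] \<tau> \<sigma> \<open>countable Z\<close> by blast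
qed

section \<open>Lengths of horizontal slices\<close>

text \<open>Lebesgue measure is additive on the disjoint intervals and subadditive on the covering
  ones. The former are open because only the interiors of the given triangles are disjoint, the
  latter closed because the covering triangles are.\<close>

lemma sum_length_intervals_le:
  fixes l r :: "'i \<Rightarrow> real" and l' r' :: "'k \<Rightarrow> real"
  assumes "finite I" "finite K"
    and "\<And>i. i \<in> I \<Longrightarrow> l i \<le> r i" "\<And>k. k \<in> K \<Longrightarrow> l' k \<le> r' k"
    and "disjoint_family_on (\<lambda>i. {l i<..<r i}) I"
    and "(\<Union>i\<in>I. {l i<..<r i}) \<subseteq> (\<Union>k\<in>K. {l' k..r' k})"
  shows "(\<Sum>i\<in>I. r i - l i) \<le> (\<Sum>k\<in>K. r' k - l' k)"
proof -
  have "ennreal (\<Sum>i\<in>I. r i - l i) = (\<Sum>i\<in>I. emeasure lborel {l i<..<r i})"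
    using assms by (simp add: sum_ennreal)
  also have "\<dots> = emeasure lborel (\<Union>i\<in>I. {l i<..<r i})"
    using assms by (intro sum_emeasure) auto
  also have "\<dots> \<le> emeasure lborel (\<Union>k\<in>K. {l' k..r' k})"
    using assms by (intro emeasure_mono sets.finite_UN) auto
  also have "\<dots> \<le> (\<Sum>k\<in>K. emeasure lborel {l' k..r' k})"
    using assms by (intro emeasure_subadditive_finite) auto
  also have "\<dots> = ennreal (\<Sum>k\<in>K. r' k - l' k)"
    using assms by (simp add: sum_ennreal)
  finally show ?thesis
    using assms by (simp add: sum_nonneg)
qed

text \<open>The slice at relative height \<open>s\<close> above (\<open>\<sigma> = 1\<close>) or below (\<open>\<sigma> = - 1\<close>) the base line at level \<open>c\<close>
  is the interval from \<open>g s\<close> to \<open>g s + b * (1 - s)\<close>.\<close>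

definition sliced :: "(real^2) set \<Rightarrow> real \<Rightarrow> real \<Rightarrow> int \<Rightarrow> real \<Rightarrow> (real \<Rightarrow> real) \<Rightarrow> bool" where
  "sliced T b h \<sigma> c g \<longleftrightarrow> 0 < b \<and> 0 < h \<and> \<sigma> \<in> {1, - 1} \<and>
     (\<forall>z. let s = of_int \<sigma> * (z $ 2 - c) / h in
        (z \<in> T \<longrightarrow> 0 \<le> s \<and> s \<le> 1 \<and> g s \<le> z $ 1 \<and> z $ 1 \<le> g s + b * (1 - s)) \<and>
        (0 < s \<and> s < 1 \<and> g s < z $ 1 \<and> z $ 1 < g s + b * (1 - s) \<longrightarrow> z \<in> interior T))"

text \<open>In barycentric coordinates \<open>z = u p + v q + w r\<close> the weight
  \<open>w\<close> is the relative height of \<open>z\<close>, and \<open>b * v\<close> is its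
  horizontal distance to the edge from \<open>p\<close> to \<open>r\<close>.\<close>

lemma H_triangle_sliced:
  assumes "H_triangle T b h"
  shows "\<exists>\<sigma> c g. sliced T b h \<sigma> c g"
proof -
  \<comment> \<open>Exchanging \<open>p\<close> and \<open>q\<close> if necessary makes
    \<open>p\<close> the left end of the base, so that the edge from \<open>p\<close> to
    \<open>r\<close> bounds all slices on the left.\<close>
  obtain p q r where nc: "\<not> collinear {p, q, r}" and T: "T = convex hull {p, q, r}"
    and pq: "p $ 2 = q $ 2" and b: "b = dist p q" and h: "h = infdist r (affine hull {p, q})"
    and le: "p $ 1 \<le> q $ 1"
  proof -
    obtain p q r where *: "\<not> collinear {p, q, r}" "T = convex hull {p, q, r}"
      "p $ 2 = q $ 2" "b = dist p q" "h = infdist r (affine hull {p, q})"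
      using assms unfolding H_triangle_def by blast
    show ?thesis
    proof (cases "p $ 1 \<le> q $ 1")
      case True
      then show ?thesis using that * by blast
    next
      case False
      then show ?thesis using that[of q p r] * by (simp add: insert_commute dist_commute)
    qed
  qed
  have "p \<noteq> q"
    using nc by auto
  have b_eq: "b = q $ 1 - p $ 1"
    using le pq by (simp add: b dist_vec_def L2_set_def sum_2 dist_real_def)
  have "0 < b"
    using \<open>p \<noteq> q\<close> by (simp add: b)
  have h_eq: "h = \<bar>r $ 2 - p $ 2\<bar>"
    using infdist_horizontal_line[OF \<open>p \<noteq> q\<close> pq] by (simp add: h)
  have "r $ 2 \<noteq> p $ 2"
  proof
    assume "r $ 2 = p $ 2"
    then have "r - p = ((r $ 1 - p $ 1) / b) *\<^sub>R (q - p)"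
      using pq \<open>0 < b\<close> by (simp add: vec_eq_iff forall_2 b_eq)
    then have "collinear {0, q - p, r - p}"
      unfolding collinear_lemma by blast
    then have "collinear {q, p, r}"
      using collinear_3[of q p r] by simp
    then show False
      using nc by (simp add: insert_commute)
  qed
  then have "0 < h"
    by (simp add: h_eq)
  define \<sigma> :: int where "\<sigma> = (if p $ 2 < r $ 2 then 1 else - 1)"
  have \<sigma>: "\<sigma> \<in> {1, - 1}"
    by (simp add: \<sigma>_def)
  have hr: "r $ 2 - p $ 2 = of_int \<sigma> * h"
    by (auto simp: \<sigma>_def h_eq)
  have \<sigma>\<sigma>: "of_int \<sigma> * (of_int \<sigma> * y) = (y :: real)" for y
    using \<sigma> by auto
  define g where "g s = (1 - s) * p $ 1 + s * r $ 1" for s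
  define S where "S z = of_int \<sigma> * (z $ 2 - p $ 2) / h" for z :: "real^2"
  have upper: "0 \<le> S z \<and> S z \<le> 1 \<and> g (S z) \<le> z $ 1 \<and> z $ 1 \<le> g (S z) + b * (1 - S z)"
    if "z \<in> T" for z
  proof -
    obtain u v w where uvw: "0 \<le> u" "0 \<le> v" "0 \<le> w" "u + v + w = 1"
      and z: "z = u *\<^sub>R p + v *\<^sub>R q + w *\<^sub>R r"
      using \<open>z \<in> T\<close> unfolding T convex_hull_3 by auto
    have u: "u = 1 - v - w"
      using uvw by simp
    have "z $ 2 - p $ 2 = w * (r $ 2 - p $ 2)"
      using pq by (simp add: z u algebra_simps)
    then have "S z = w"
      using \<open>0 < h\<close> \<sigma>\<sigma>[of "w * h"] by (simp add: S_def hr mult.left_commute)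
    moreover have "z $ 1 = g w + b * v"
      by (simp add: z u g_def b_eq algebra_simps)
    moreover have "b * v \<le> b * (1 - w)" "0 \<le> b * v"
      using uvw \<open>0 < b\<close> by auto
    ultimately show ?thesis
      using uvw by auto
  qed
  \<comment> \<open>Strict inequalities make \<open>U\<close> open; being contained in
    \<open>T\<close>, it lies in the interior.\<close>
  define U where "U = {z. 0 < S z} \<inter> {z. S z < 1} \<inter> {z. g (S z) < z $ 1} \<inter> {z. z $ 1 < g (S z) + b * (1 - S z)}"
  have "open U"
    unfolding U_def S_def g_def using \<open>0 < h\<close> by (intro open_Int open_Collect_less continuous_intros) auto
  moreover have "U \<subseteq> T"
  proof
    fix z assume "z \<in> U"
    \<comment> \<open>The weight of \<open>q\<close>, recovered from the horizontal distance to the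
      left edge.\<close>
    define v where "v = (z $ 1 - g (S z)) / b"
    have "b * v = z $ 1 - g (S z)"
      using \<open>0 < b\<close> by (simp add: v_def)
    have "0 \<le> v" "v \<le> 1 - S z" "0 \<le> S z"
      using \<open>z \<in> U\<close> \<open>0 < b\<close> by (auto simp: v_def U_def field_simps)
    moreover have "z = (1 - v - S z) *\<^sub>R p + v *\<^sub>R q + S z *\<^sub>R r"
    proof -
      have "z $ 1 = (1 - v - S z) * p $ 1 + v * q $ 1 + S z * r $ 1"
        using \<open>b * v = z $ 1 - g (S z)\<close> by (simp add: g_def b_eq algebra_simps)
      moreover have "S z * (r $ 2 - p $ 2) = z $ 2 - p $ 2"
        using \<open>0 < h\<close> \<sigma>\<sigma>[of "z $ 2 - p $ 2"] by (simp add: S_def hr mult.left_commute mult.commute)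
      then have "z $ 2 = (1 - v - S z) * p $ 2 + v * q $ 2 + S z * r $ 2"
        using pq by (simp add: algebra_simps)
      ultimately show ?thesis
        by (simp add: vec_eq_iff forall_2)
    qed
    ultimately show "z \<in> T"
      unfolding T convex_hull_3
      by (intro CollectI exI[of _ "1 - v - S z"] exI[of _ v] exI[of _ "S z"]) auto
  qed
  ultimately have "U \<subseteq> interior T"
    by (rule interior_maximal[rotated])
  then show ?thesis
    using \<open>0 < b\<close> \<open>0 < h\<close> \<sigma> upper unfolding sliced_def Let_def
    by (intro exI[of _ \<sigma>] exI[of _ "p $ 2"] exI[of _ g]) (auto simp: U_def S_def)
qed

text \<open>At level \<open>y\<close> the interiors give disjoint open slices, covered by the closed
  slices of the \<open>S k\<close>. Base levels of the \<open>T i\<close> are excluded: there two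
  triangles on opposite sides of a common base line could count the same segment twice.\<close>

lemma sum_slice_lengths_le:
  fixes \<tau> \<sigma> :: "nat \<Rightarrow> int"
  assumes T: "\<And>i. i < n \<Longrightarrow> sliced (T i) (b i) (h i) (\<tau> i) (a i) (f i)"
    and S: "\<And>k. k < m \<Longrightarrow> sliced (S k) (b' k) (h' k) (\<sigma> k) (c k) (g k)"
    and disj: "\<And>i j. i < n \<Longrightarrow> j < n \<Longrightarrow> i \<noteq> j \<Longrightarrow> interior (T i) \<inter> interior (T j) = {}"
    and cover: "(\<Union>i<n. T i) \<subseteq> (\<Union>k<m. S k)"
    and y: "y \<notin> a ` {..<n}"
  shows "(\<Sum>i<n. b i * hat (of_int (\<tau> i) * (y - a i) / h i))
           \<le> (\<Sum>k<m. b' k * hat (of_int (\<sigma> k) * (y - c k) / h' k))"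
proof -
  define s where "s i = of_int (\<tau> i) * (y - a i) / h i" for i
  define t where "t k = of_int (\<sigma> k) * (y - c k) / h' k" for k
  define pt where "pt x = (\<chi> i::2. if i = 1 then x else y)" for x
  have pt: "pt x $ 1 = x" "pt x $ 2 = y" for x
    by (auto simp: pt_def)
  \<comment> \<open>Heights are strict in \<open>I\<close>, where slices of interiors are taken;
    \<open>K\<close> admits 0 and 1, so that boundary points of the cover count as well.\<close>
  define I where "I = {i. i < n \<and> 0 < s i \<and> s i < 1}"
  define K where "K = {k. k < m \<and> 0 \<le> t k \<and> t k \<le> 1}"
  define J where "J i = {f i (s i)<..<f i (s i) + b i * (1 - s i)}" for i
  have J: "pt x \<in> interior (T i)" if "i \<in> I" "x \<in> J i" for i x
    using that T[of i] by (auto simp: sliced_def Let_def I_def J_def pt s_def)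
  have "(\<Sum>i<n. b i * hat (s i)) = (\<Sum>i\<in>I. b i * hat (s i))"
  proof (intro sum.mono_neutral_right ballI)
    fix i assume "i \<in> {..<n} - I"
    moreover from this have "s i \<noteq> 0"
      using y T[of i] by (auto simp: s_def sliced_def)
    ultimately show "b i * hat (s i) = 0"
      by (auto simp: I_def hat_def)
  qed (auto simp: I_def)
  also have "\<dots> = (\<Sum>i\<in>I. (f i (s i) + b i * (1 - s i)) - f i (s i))"
    by (intro sum.cong) (auto simp: I_def hat_def)
  also have "\<dots> \<le> (\<Sum>k\<in>K. (g k (t k) + b' k * (1 - t k)) - g k (t k))"
  proof (rule sum_length_intervals_le)
    show "disjoint_family_on (\<lambda>i. {f i (s i)<..<f i (s i) + b i * (1 - s i)}) I"
      unfolding disjoint_family_on_def J_def[symmetric]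
    proof (intro ballI impI)
      fix i j assume "i \<in> I" "j \<in> I" "i \<noteq> j"
      then show "J i \<inter> J j = {}"
        using disj[of i j] J[of i] J[of j] by (auto simp: I_def)
    qed
    show "(\<Union>i\<in>I. {f i (s i)<..<f i (s i) + b i * (1 - s i)}) \<subseteq> (\<Union>k\<in>K. {g k (t k)..g k (t k) + b' k * (1 - t k)})"
      unfolding J_def[symmetric]
    proof
      fix x assume "x \<in> (\<Union>i\<in>I. J i)"
      then have "pt x \<in> (\<Union>i<n. T i)"
        using J interior_subset by (fastforce simp: I_def)
      then obtain k where "k < m" "pt x \<in> S k"
        using cover by blast
      then show "x \<in> (\<Union>k\<in>K. {g k (t k)..g k (t k) + b' k * (1 - t k)})"
        using S[of k] by (auto simp: sliced_def Let_def K_def t_def dest!: spec[of _ "pt x"] simp: pt intro!: bexI[of _ k])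
    qed
    show "f i (s i) \<le> f i (s i) + b i * (1 - s i)" if "i \<in> I" for i
      using that T[of i] by (auto simp: I_def sliced_def)
    show "g k (t k) \<le> g k (t k) + b' k * (1 - t k)" if "k \<in> K" for k
      using that S[of k] by (auto simp: K_def sliced_def)
  qed (auto simp: I_def K_def)
  also have "\<dots> = (\<Sum>k\<in>K. b' k * hat (t k))"
    by (intro sum.cong) (auto simp: K_def hat_def)
  also have "\<dots> = (\<Sum>k<m. b' k * hat (t k))"
    by (intro sum.mono_neutral_left) (auto simp: K_def hat_def)
  finally show ?thesis
    by (simp add: s_def t_def)
qed

theorem theorem3:
  fixes n :: nat and b h :: real and T :: "nat \<Rightarrow> (real^2) set" and X :: "(real^2) set"
  assumes "n \<ge> 1" and "b > 0" and "h > 0"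
    and "\<And>i. i < n \<Longrightarrow> H_triangle (T i) b h"
    and "\<And>i j. i < n \<Longrightarrow> j < n \<Longrightarrow> i \<noteq> j \<Longrightarrow> interior (T i) \<inter> interior (T j) = {}"
    and "X = (\<Union>i<n. T i)"
  shows "\<not> (\<exists>S :: nat \<Rightarrow> (real^2) set.
            (\<forall>k<n + 1. \<exists>b' h'. H_triangle (S k) b' h' \<and> b' < b \<and> h' < h) \<and>
            X \<subseteq> (\<Union>k<n + 1. S k))"
proof (intro notI, elim exE conjE)
  fix S :: "nat \<Rightarrow> (real^2) set"
  assume small: "\<forall>k<n + 1. \<exists>b' h'. H_triangle (S k) b' h' \<and> b' < b \<and> h' < h"
    and cover: "X \<subseteq> (\<Union>k<n + 1. S k)"
  have "\<forall>i. \<exists>\<tau> a f. i < n \<longrightarrow> sliced (T i) b h \<tau> a f"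
    using assms(4) H_triangle_sliced by blast
  then obtain \<tau> a f where T: "\<And>i. i < n \<Longrightarrow> sliced (T i) b h (\<tau> i) (a i) (f i)"
    by metis
  have "\<forall>k. \<exists>b' h' \<sigma> c g. k < n + 1 \<longrightarrow> sliced (S k) b' h' \<sigma> c g \<and> b' < b \<and> h' < h"
    using small H_triangle_sliced by blast
  then obtain b' h' \<sigma> c g where S: "\<And>k. k < n + 1 \<Longrightarrow> sliced (S k) (b' k) (h' k) (\<sigma> k) (c k) (g k)"
    and less: "\<And>k. k < n + 1 \<Longrightarrow> b' k < b" "\<And>k. k < n + 1 \<Longrightarrow> h' k < h"
    by metis
  \<comment> \<open>The largest ratio of base or height: a maximum of finitely many numbers below 1,
    it turns the strict inequalities into a uniform factor.\<close>
  define l where "l = Max ((\<lambda>k. max (b' k / b) (h' k / h)) ` {..<n + 1})"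
  have l_ge: "max (b' k / b) (h' k / h) \<le> l" if "k < n + 1" for k
    unfolding l_def using that by (intro Max_ge) auto
  have "l \<in> (\<lambda>k. max (b' k / b) (h' k / h)) ` {..<n + 1}"
    unfolding l_def by (intro Max_in) auto
  then obtain k where "k < n + 1" "l = max (b' k / b) (h' k / h)"
    by auto
  then have "0 < l" "l < 1"
    using S[of k] less[of k] \<open>b > 0\<close> \<open>h > 0\<close> by (auto simp: sliced_def less_max_iff_disj)
  have le: "b' k \<le> l * b" "h' k \<le> l * h" if "k < n + 1" for k
    using l_ge[OF that] \<open>b > 0\<close> \<open>h > 0\<close> by (auto simp: field_simps)
  show False
  proof (rule hat_sums_contradiction[OF \<open>n \<ge> 1\<close> \<open>0 < l\<close> \<open>l < 1\<close>])
    show "\<tau> i \<in> {1, - 1}" if "i < n" for i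
      using T[OF that] by (simp add: sliced_def)
    show "\<sigma> k \<in> {1, - 1}" if "k < n + 1" for k
      using S[OF that] by (simp add: sliced_def)
    fix u assume u: "u \<notin> (\<lambda>i. a i / (l * h)) ` {..<n}"
    \<comment> \<open>In the unit \<open>l * h\<close> the enlarged covering triangles have height 1
      and the given ones height \<open>1 / l\<close>.\<close>
    define y where "y = u * (l * h)"
    have "y \<notin> a ` {..<n}"
      using u \<open>0 < l\<close> \<open>h > 0\<close> by (auto simp: y_def image_iff field_simps)
    have "b * (\<Sum>i<n. hat (l * (of_int (\<tau> i) * (u - a i / (l * h)))))
          = (\<Sum>i<n. b * hat (of_int (\<tau> i) * (y - a i) / h))"
      unfolding sum_distrib_left
    proof (intro sum.cong refl)
      fix i
      have "l * (of_int (\<tau> i) * (u - a i / (l * h))) = of_int (\<tau> i) * (y - a i) / h"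
        using \<open>0 < l\<close> \<open>h > 0\<close> by (simp add: y_def field_simps)
      then show "b * hat (l * (of_int (\<tau> i) * (u - a i / (l * h)))) = b * hat (of_int (\<tau> i) * (y - a i) / h)"
        by simp
    qed
    also have "\<dots> \<le> (\<Sum>k<n + 1. b' k * hat (of_int (\<sigma> k) * (y - c k) / h' k))"
      using sum_slice_lengths_le[of n T "\<lambda>_. b" "\<lambda>_. h" \<tau> a f "n + 1" S b' h' \<sigma> c g y]
        T S assms(5) cover \<open>X = (\<Union>i<n. T i)\<close> \<open>y \<notin> a ` {..<n}\<close> by blast
    \<comment> \<open>Each covering triangle is enlarged to base \<open>l * b\<close> and height
      \<open>l * h\<close> over the same base line.\<close>
    also have "\<dots> \<le> (\<Sum>k<n + 1. (l * b) * hat (of_int (\<sigma> k) * (y - c k) / (l * h)))"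
      using S le \<open>0 < l\<close> \<open>b > 0\<close> by (intro sum_mono hat_scale_mono) (auto simp: sliced_def)
    also have "\<dots> = b * (l * (\<Sum>k<n + 1. hat (of_int (\<sigma> k) * (u - c k / (l * h)))))"
      unfolding sum_distrib_left
    proof (intro sum.cong refl)
      fix k
      have "of_int (\<sigma> k) * (y - c k) / (l * h) = of_int (\<sigma> k) * (u - c k / (l * h))"
        using \<open>0 < l\<close> \<open>h > 0\<close> by (simp add: y_def field_simps)
      then show "(l * b) * hat (of_int (\<sigma> k) * (y - c k) / (l * h)) = b * (l * hat (of_int (\<sigma> k) * (u - c k / (l * h))))"
        by simp
    qed
    finally show "(\<Sum>i<n. hat (l * (of_int (\<tau> i) * (u - a i / (l * h)))))
        \<le> l * (\<Sum>k<n + 1. hat (of_int (\<sigma> k) * (u - c k / (l * h))))"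
      using \<open>b > 0\<close> by simp
  qed
qed

end
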